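(* Let $X$ and $Y$ be nonzero complex Banach spaces, let $n$ be a positive integer, and let $S_1,T_1\in B(X)$ and $S_2,T_2\in B(Y)$. Then the following are equivalent: (a) $S_1\otimes S_2$ is a left $n$-inverse of $T_1\otimes T_2$ in $B(X\overline\otimes Y)$. (b) There exist positive integers $l,m$ with $l+m=n+1$ and $\lambda\in\mathbb{C}^\ast$ such that $S_1$ is a left $l$-inverse of $\lambda T_1$ in $B(X)$ and $S_2$ is a left $m$-inverse of $(1/\lambda)T_2$ in $B(Y)$. Moreover, the equivalence also holds when "left $n$-inverse", "left $l$-inverse" and "left $m$-inverse" are replaced throughout (in both (a) and (b)) by "strict left $n$-inverse", "strict left $l$-inverse" and "strict left $m$-inverse", respectively.
   Context: $\mathbb{C}^\ast$ is the set of nonzero complex numbers. $B(X)$ is the algebra of bounded linear operators on a Banach space $X$. For elements $S,T$ of a unital $\mathbb{C}$-algebra define $\beta_n(S,T)=\sum_{k=0}^n(-1)^{n-k}\binom{n}{k}S^kT^k$ (so $\beta_0(S,T)=1$). $S$ is a left $n$-inverse of $T$ if $\beta_n(S,T)=0$; it is a strict left $n$-inverse of $T$ if in addition $\beta_{n-1}(S,T)\neq 0$. $X\overline\otimes Y$ denotes the completion of the algebraic tensor product $X\otimes Y$ with respect to a (fixed) reasonable uniform cross norm, i.e. a reasonable cross norm such that for all $S\in B(X)$, $T\in B(Y)$ the operator $S\otimes T$ on $X\otimes Y$ is bounded with norm at most $\|S\|\,\|T\|$ and hence extends to an element $S\otimes T\in B(X\overline\otimes Y)$. *)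

theory Defs
  imports "HOL-Analysis.Analysis"
begin

section \<open>Complex Banach spaces\<close>

text \<open>
  HOL-Analysis only has type classes for real normed spaces.  A complex normed space is one that
  carries in addition a complex scalar multiplication which extends the real one and for which the
  norm is homogeneous.
\<close>

class scaleC =
  fixes scaleC :: "complex \<Rightarrow> 'a \<Rightarrow> 'a" (infixr \<open>*\<^sub>C\<close> 75)

class complex_vector = ab_group_add + scaleC +
  assumes scaleC_add_right: "c *\<^sub>C (x + y) = c *\<^sub>C x + c *\<^sub>C y"
    and scaleC_add_left: "(c + d) *\<^sub>C x = c *\<^sub>C x + d *\<^sub>C x"
    and scaleC_scaleC: "c *\<^sub>C (d *\<^sub>C x) = (c * d) *\<^sub>C x"
    and scaleC_one: "1 *\<^sub>C x = x"

class complex_normed_vector = complex_vector + real_normed_vector +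
  assumes scaleR_scaleC: "r *\<^sub>R x = complex_of_real r *\<^sub>C x"
    and norm_scaleC: "norm (c *\<^sub>C x) = norm c * norm x"

class complex_banach = complex_normed_vector + banach

instantiation complex :: complex_banach
begin
definition scaleC_complex_def: "c *\<^sub>C (z::complex) = c * z"
instance
  by standard (auto simp: scaleC_complex_def algebra_simps norm_mult scaleR_conv_of_real)
end

global_interpretation complex_vector: vector_space
  "scaleC :: complex \<Rightarrow> 'a \<Rightarrow> 'a::complex_vector"
  by standard (simp_all add: scaleC_add_right scaleC_add_left scaleC_scaleC scaleC_one)

abbreviation clinear :: "('a::complex_vector \<Rightarrow> 'b::complex_vector) \<Rightarrow> bool" where
  "clinear \<equiv> Vector_Spaces.linear scaleC scaleC"

lemma clinear_iff:
  "clinear f \<longleftrightarrow> (\<forall>x y. f (x + y) = f x + f y) \<and> (\<forall>c x. f (c *\<^sub>C x) = c *\<^sub>C f x)"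
  unfolding Vector_Spaces.linear_def module_hom_axioms_def module_hom_def
  by (simp add: complex_vector.vector_space_axioms complex_vector.module_axioms)

definition cbilinear ::
  "('a::complex_vector \<Rightarrow> 'b::complex_vector \<Rightarrow> 'c::complex_vector) \<Rightarrow> bool" where
  "cbilinear B \<longleftrightarrow> (\<forall>x. clinear (B x)) \<and> (\<forall>y. clinear (\<lambda>x. B x y))"

definition bounded_clinear ::
  "('a::complex_normed_vector \<Rightarrow> 'b::complex_normed_vector) \<Rightarrow> bool" where
  "bounded_clinear f \<longleftrightarrow> clinear f \<and> bounded_linear f"


section \<open>Unital complex algebras and left $n$-inverses\<close>

text \<open>The condition $0 \neq 1$ is not imposed.\<close>

class complex_unital_algebra = complex_vector + ring + monoid_mult +
  assumes mult_scaleC_left: "(c *\<^sub>C x) * y = c *\<^sub>C (x * y)"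
    and mult_scaleC_right: "x * (c *\<^sub>C y) = c *\<^sub>C (x * y)"

definition beta :: "nat \<Rightarrow> 'a::complex_unital_algebra \<Rightarrow> 'a \<Rightarrow> 'a" where
  "beta n S T = (\<Sum>k=0..n. ((-1) ^ (n - k) * of_nat (n choose k)) *\<^sub>C (S ^ k * T ^ k))"

definition left_n_inverse :: "nat \<Rightarrow> 'a::complex_unital_algebra \<Rightarrow> 'a \<Rightarrow> bool" where
  "left_n_inverse n S T \<longleftrightarrow> beta n S T = 0"

text \<open>To be used for $n \geq 1$ only, because of the truncated subtraction.\<close>

definition strict_left_n_inverse :: "nat \<Rightarrow> 'a::complex_unital_algebra \<Rightarrow> 'a \<Rightarrow> bool" where
  "strict_left_n_inverse n S T \<longleftrightarrow> left_n_inverse n S T \<and> beta (n - 1) S T \<noteq> 0"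


section \<open>The algebra $B(X)$\<close>

typedef (overloaded) 'a bop =
  "{F :: 'a::complex_banach \<Rightarrow>\<^sub>L 'a. clinear (blinfun_apply F)}"
  morphisms blinfun_of Bop
  by (rule exI[of _ id_blinfun]) (simp add: clinear_iff)

setup_lifting type_definition_bop

definition bop_apply :: "'a::complex_banach bop \<Rightarrow> 'a \<Rightarrow> 'a" where
  "bop_apply S = blinfun_apply (blinfun_of S)"

definition bop_norm :: "'a::complex_banach bop \<Rightarrow> real" where
  "bop_norm S = norm (blinfun_of S)"

instantiation bop :: (complex_banach) complex_unital_algebra
begin

lift_definition zero_bop :: "'a bop" is 0
  by (simp add: clinear_iff)

lift_definition plus_bop :: "'a bop \<Rightarrow> 'a bop \<Rightarrow> 'a bop" is "(+)"
  by (simp add: clinear_iff blinfun.add_left scaleC_add_right)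

lift_definition minus_bop :: "'a bop \<Rightarrow> 'a bop \<Rightarrow> 'a bop" is "(-)"
  by (simp add: clinear_iff blinfun.diff_left complex_vector.scale_right_diff_distrib)

lift_definition uminus_bop :: "'a bop \<Rightarrow> 'a bop" is uminus
  by (simp add: clinear_iff blinfun.minus_left)

lift_definition one_bop :: "'a bop" is id_blinfun
  by (simp add: clinear_iff)

lift_definition times_bop :: "'a bop \<Rightarrow> 'a bop \<Rightarrow> 'a bop" is "(o\<^sub>L)"
  by (simp add: clinear_iff)

lemma bounded_linear_scaleC:
  "bounded_linear (\<lambda>x. c *\<^sub>C (x::'b::complex_normed_vector))"
  by (rule bounded_linear_intro[of _ "norm c"])
    (simp_all add: scaleC_add_right scaleR_scaleC norm_scaleC mult.commute)

lift_definition scaleC_bop :: "complex \<Rightarrow> 'a bop \<Rightarrow> 'a bop" is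
  "\<lambda>c F. Blinfun (\<lambda>x. c *\<^sub>C x) o\<^sub>L F"
  by (simp add: clinear_iff bounded_linear_Blinfun_apply bounded_linear_scaleC
      scaleC_add_right mult.commute)

instance
  by standard
    (transfer; auto intro!: blinfun_eqI
      simp: bounded_linear_Blinfun_apply bounded_linear_scaleC blinfun.add_left blinfun.add_right
        blinfun.diff_left blinfun.minus_left scaleC_add_right scaleC_add_left clinear_iff)+

end

lemma bop_apply_simps:
  "bop_apply 0 x = 0"
  "bop_apply 1 x = x"
  "bop_apply (S + T) x = bop_apply S x + bop_apply T x"
  "bop_apply (S * T) x = bop_apply S (bop_apply T x)"
  "bop_apply (c *\<^sub>C S) x = c *\<^sub>C bop_apply S x"
  unfolding bop_apply_def
  by (transfer; simp add: blinfun.add_left bounded_linear_Blinfun_apply bounded_linear_scaleC)+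

lemma bop_eqI: "(\<And>x. bop_apply S x = bop_apply T x) \<Longrightarrow> S = T"
  unfolding bop_apply_def by transfer (rule blinfun_eqI)

lemma bounded_clinear_bop_apply: "bounded_clinear (bop_apply S)"
  using blinfun_of[of S] by (simp add: bounded_clinear_def bop_apply_def blinfun.bounded_linear_right)

lemma bop_exists: "bounded_clinear f \<Longrightarrow> \<exists>S. bop_apply S = f"
  by (metis bounded_clinear_def bop_apply_def Bop_inverse bounded_linear_Blinfun_apply mem_Collect_eq)


section \<open>The algebraic tensor product\<close>

text \<open>
  As in Ryan's book, $x \otimes y$ is evaluation at $(x,y)$ on the space of bilinear forms on
  $X \times Y$, and $X \otimes Y$ is the linear span of these functionals.  Scalars can be absorbed
  into the first factor, so the span consists of the finite sums.  The functionals take the junk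
  value \<open>0\<close> at functions that are not bilinear.
\<close>

definition tensor_sum ::
  "('a::complex_vector \<times> 'b::complex_vector) list \<Rightarrow> ('a \<Rightarrow> 'b \<Rightarrow> complex) \<Rightarrow> complex" where
  "tensor_sum xs = (\<lambda>B. if cbilinear B then (\<Sum>(x, y)\<leftarrow>xs. B x y) else 0)"

typedef (overloaded) ('a::complex_vector, 'b::complex_vector) tensor =
  "range (tensor_sum :: ('a \<times> 'b) list \<Rightarrow> _)"
  by blast

setup_lifting type_definition_tensor

lemma cbilinear_scale_left: "cbilinear B \<Longrightarrow> B (c *\<^sub>C x) y = c *\<^sub>C B x y"
  by (simp add: cbilinear_def clinear_iff)

lemma tensor_sum_append: "tensor_sum (xs @ ys) = (\<lambda>B. tensor_sum xs B + tensor_sum ys B)"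
  by (auto simp: tensor_sum_def)

lemma tensor_sum_scale:
  "tensor_sum (map (\<lambda>(x, y). (c *\<^sub>C x, y)) xs) = (\<lambda>B. c * tensor_sum xs B)"
proof
  fix B :: "'a \<Rightarrow> 'b \<Rightarrow> complex"
  show "tensor_sum (map (\<lambda>(x, y). (c *\<^sub>C x, y)) xs) B = c * tensor_sum xs B"
  proof (cases "cbilinear B")
    case True
    then have "(\<Sum>(x, y)\<leftarrow>map (\<lambda>(x, y). (c *\<^sub>C x, y)) xs. B x y) = c * (\<Sum>(x, y)\<leftarrow>xs. B x y)"
      by (induction xs)
        (auto simp: cbilinear_scale_left scaleC_complex_def algebra_simps)
    with True show ?thesis by (simp add: tensor_sum_def)
  qed (simp add: tensor_sum_def)
qed

lemma tensor_sum_uminus: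
  "tensor_sum (map (\<lambda>(x, y). ((-1) *\<^sub>C x, y)) xs) = (\<lambda>B. - tensor_sum xs B)"
  by (subst tensor_sum_scale) simp

lemma tensor_sum_minus:
  "tensor_sum (xs @ map (\<lambda>(x, y). ((-1) *\<^sub>C x, y)) ys) = (\<lambda>B. tensor_sum xs B - tensor_sum ys B)"
  by (simp only: tensor_sum_append tensor_sum_uminus) simp

instantiation tensor :: (complex_vector, complex_vector) complex_vector
begin

lift_definition zero_tensor :: "('a, 'b) tensor" is "\<lambda>B. 0"
  by (rule range_eqI[of _ _ "[]"]) (auto simp: tensor_sum_def)

lift_definition plus_tensor :: "('a, 'b) tensor \<Rightarrow> ('a, 'b) tensor \<Rightarrow> ('a, 'b) tensor" is
  "\<lambda>u v B. u B + v B"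
  by (auto simp flip: tensor_sum_append)

lift_definition scaleC_tensor :: "complex \<Rightarrow> ('a, 'b) tensor \<Rightarrow> ('a, 'b) tensor" is
  "\<lambda>c u B. c * u B"
  by (auto simp flip: tensor_sum_scale)

lift_definition uminus_tensor :: "('a, 'b) tensor \<Rightarrow> ('a, 'b) tensor" is "\<lambda>u B. - u B"
  by (auto simp flip: tensor_sum_uminus)

lift_definition minus_tensor :: "('a, 'b) tensor \<Rightarrow> ('a, 'b) tensor \<Rightarrow> ('a, 'b) tensor" is
  "\<lambda>u v B. u B - v B"
  by (auto simp flip: tensor_sum_minus)

instance
  by standard (transfer; auto simp: algebra_simps)+

end

lift_definition tensor :: "'a::complex_vector \<Rightarrow> 'b::complex_vector \<Rightarrow> ('a, 'b) tensor"
  (infixr \<open>\<otimes>\<close> 70)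
  is "\<lambda>x y. tensor_sum [(x, y)]"
  by simp

text \<open>
  The linear map on $X \otimes Y$ induced by a bilinear map on $X \times Y$; the universal
  property below shows that it is well defined.
\<close>

definition tensor_lift ::
  "('a::complex_vector \<Rightarrow> 'b::complex_vector \<Rightarrow> 'c::complex_vector) \<Rightarrow> ('a, 'b) tensor \<Rightarrow> 'c" where
  "tensor_lift f = (THE g. clinear g \<and> (\<forall>x y. g (x \<otimes> y) = f x y))"

lemma tensor_eq_sum_list: "\<exists>xs. u = (\<Sum>(x, y)\<leftarrow>xs. x \<otimes> y)"
proof -
  have *: "Rep_tensor (\<Sum>(x, y)\<leftarrow>xs. x \<otimes> y) = tensor_sum xs" for xs :: "('a \<times> 'b) list"
  proof (induction xs)
    case Nil
    show ?case by (auto simp: zero_tensor.rep_eq tensor_sum_def)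
  next
    case (Cons p xs)
    then show ?case
      using tensor_sum_append[of "[p]" xs]
      by (cases p) (simp add: plus_tensor.rep_eq tensor.rep_eq)
  qed
  obtain xs where "Rep_tensor u = tensor_sum xs"
    using Rep_tensor[of u] by blast
  then show ?thesis using *[of xs] by (metis Rep_tensor_inject)
qed

lemma Rep_tensor_sum_list:
  "cbilinear B \<Longrightarrow> Rep_tensor (\<Sum>(x, y)\<leftarrow>xs. x \<otimes> y) B = (\<Sum>(x, y)\<leftarrow>xs. B x y)"
  by (induction xs) (auto simp: zero_tensor.rep_eq plus_tensor.rep_eq tensor.rep_eq tensor_sum_def)

lemma tensor_add_left: "(x + x') \<otimes> y = x \<otimes> y + x' \<otimes> y"
  and tensor_add_right: "x \<otimes> (y + y') = x \<otimes> y + x \<otimes> y'"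
  and tensor_scaleC_left: "(c *\<^sub>C x) \<otimes> y = c *\<^sub>C (x \<otimes> y)"
  and tensor_scaleC_right: "x \<otimes> (c *\<^sub>C y) = c *\<^sub>C (x \<otimes> y)"
  by (transfer; auto simp: tensor_sum_def cbilinear_def clinear_iff scaleC_complex_def)+

lemma cbilinear_tensor: "cbilinear (\<otimes>)"
  by (simp add: cbilinear_def clinear_iff tensor_add_left tensor_add_right
      tensor_scaleC_left tensor_scaleC_right)

lemma clinear_separates:
  fixes z :: "'c::complex_vector"
  assumes "z \<noteq> 0"
  shows "\<exists>g :: 'c \<Rightarrow> complex. clinear g \<and> g z \<noteq> 0"
proof -
  interpret vector_space_pair "scaleC :: complex \<Rightarrow> 'c \<Rightarrow> 'c" "scaleC :: complex \<Rightarrow> complex \<Rightarrow> complex"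
    by unfold_locales
  have "complex_vector.independent {z}" using assms by simp
  from linear_independent_extend[OF this, of "\<lambda>_. 1"]
  show ?thesis by force
qed

lemma clinear_sum_list:
  "clinear g \<Longrightarrow> g (\<Sum>(x, y)\<leftarrow>xs. f x y) = (\<Sum>(x, y)\<leftarrow>xs. g (f x y))"
proof (induction xs)
  case Nil
  then show ?case by (metis clinear_iff add_cancel_right_right list.map(1) sum_list.Nil)
next
  case (Cons p xs)
  then show ?case by (cases p) (simp add: clinear_iff)
qed

lemma tensor_universal:
  assumes f: "cbilinear f"
  shows "\<exists>!g. clinear g \<and> (\<forall>x y. g (x \<otimes> y) = f x y)"
proof -
  let ?s = "\<lambda>xs :: ('a \<times> 'b) list. \<Sum>(x, y)\<leftarrow>xs. x \<otimes> y"
    and ?t = "\<lambda>xs :: ('a \<times> 'b) list. \<Sum>(x, y)\<leftarrow>xs. f x y"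
  have wd: "?t xs = ?t ys" if eq: "?s xs = ?s ys" for xs ys
  proof (rule ccontr)
    assume "?t xs \<noteq> ?t ys"
    then obtain g :: "'c \<Rightarrow> complex" where g: "clinear g" "g (?t xs - ?t ys) \<noteq> 0"
      using clinear_separates[of "?t xs - ?t ys"] by auto
    have "g (?t xs) = g (?t ys + (?t xs - ?t ys))" by simp
    also have "\<dots> = g (?t ys) + g (?t xs - ?t ys)" using g(1) unfolding clinear_iff by blast
    finally have ne: "g (?t xs) \<noteq> g (?t ys)" using g(2) by simp
    have B: "cbilinear (\<lambda>x y. g (f x y))"
      using f g(1) by (simp add: cbilinear_def clinear_iff)
    have "g (?t zs) = Rep_tensor (?s zs) (\<lambda>x y. g (f x y))" for zs
      by (simp only: Rep_tensor_sum_list[OF B] clinear_sum_list[OF g(1)])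
    with eq ne show False by metis
  qed
  define h where "h u = ?t (SOME xs. u = ?s xs)" for u
  have h: "h (?s xs) = ?t xs" for xs
    unfolding h_def by (rule wd, rule someI2[where a = xs]) auto
  have add: "h (u + v) = h u + h v" for u v
  proof -
    obtain xs ys where "u = ?s xs" "v = ?s ys" using tensor_eq_sum_list by metis
    then show ?thesis using h[of "xs @ ys"] h[of xs] h[of ys] by simp
  qed
  have scale: "h (c *\<^sub>C u) = c *\<^sub>C h u" for c u
  proof -
    obtain xs where u: "u = ?s xs" using tensor_eq_sum_list by metis
    have "?s (map (\<lambda>(x, y). (c *\<^sub>C x, y)) xs) = c *\<^sub>C ?s xs"
      by (induction xs) (auto simp: tensor_scaleC_left scaleC_add_right)
    moreover have "?t (map (\<lambda>(x, y). (c *\<^sub>C x, y)) xs) = c *\<^sub>C ?t xs"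
      by (induction xs) (auto simp: cbilinear_scale_left[OF f] scaleC_add_right)
    ultimately show ?thesis using u h by metis
  qed
  have ht: "h (x \<otimes> y) = f x y" for x y using h[of "[(x, y)]"] by simp
  show ?thesis
  proof (rule ex1I[of _ h])
    show "clinear h \<and> (\<forall>x y. h (x \<otimes> y) = f x y)"
      using add scale ht by (simp add: clinear_iff)
    fix g assume g: "clinear g \<and> (\<forall>x y. g (x \<otimes> y) = f x y)"
    show "g = h"
    proof
      fix u
      obtain xs where u: "u = ?s xs" using tensor_eq_sum_list by metis
      have "g (?s xs) = ?t xs" using clinear_sum_list[of g tensor xs] g by simp
      then show "g u = h u" using u h by simp
    qed
  qed
qed

lemma clinear_tensor_lift: "cbilinear f \<Longrightarrow> clinear (tensor_lift f)"
  and tensor_lift_tensor: "cbilinear f \<Longrightarrow> tensor_lift f (x \<otimes> y) = f x y"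
  using theI'[OF tensor_universal[of f]] unfolding tensor_lift_def by blast+

definition tensor_map ::
  "'a::complex_banach bop \<Rightarrow> 'b::complex_banach bop \<Rightarrow> ('a, 'b) tensor \<Rightarrow> ('a, 'b) tensor" where
  "tensor_map S T = tensor_lift (\<lambda>x y. bop_apply S x \<otimes> bop_apply T y)"

lemma cbilinear_tensor_map: "cbilinear (\<lambda>x y. bop_apply S x \<otimes> bop_apply T y)"
  using bounded_clinear_bop_apply[of S] bounded_clinear_bop_apply[of T]
  by (simp add: bounded_clinear_def cbilinear_def clinear_iff tensor_add_left tensor_add_right
      tensor_scaleC_left tensor_scaleC_right)

lemma tensor_map_tensor: "tensor_map S T (x \<otimes> y) = bop_apply S x \<otimes> bop_apply T y"
  unfolding tensor_map_def by (rule tensor_lift_tensor[OF cbilinear_tensor_map])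

lemma clinear_tensor_map: "clinear (tensor_map S T)"
  unfolding tensor_map_def by (rule clinear_tensor_lift[OF cbilinear_tensor_map])


section \<open>Reasonable uniform cross norms and the completed tensor product\<close>

definition cnorm :: "('v::complex_vector \<Rightarrow> real) \<Rightarrow> bool" where
  "cnorm \<alpha> \<longleftrightarrow>
     (\<forall>u. 0 \<le> \<alpha> u) \<and> (\<forall>u. \<alpha> u = 0 \<longleftrightarrow> u = 0) \<and>
     (\<forall>u v. \<alpha> (u + v) \<le> \<alpha> u + \<alpha> v) \<and> (\<forall>c u. \<alpha> (c *\<^sub>C u) = norm c * \<alpha> u)"

text \<open>
  The second clause says that every simple tensor $\varphi \otimes \psi$ of the dual spaces is a
  bounded functional on $(X \otimes Y, \alpha)$ of norm at most $\|\varphi\|\,\|\psi\|$.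
\<close>

definition reasonable_cross_norm ::
  "(('a::complex_banach, 'b::complex_banach) tensor \<Rightarrow> real) \<Rightarrow> bool" where
  "reasonable_cross_norm \<alpha> \<longleftrightarrow>
     cnorm \<alpha> \<and>
     (\<forall>x y. \<alpha> (x \<otimes> y) \<le> norm x * norm y) \<and>
     (\<forall>(\<phi> :: 'a \<Rightarrow> complex) (\<psi> :: 'b \<Rightarrow> complex). bounded_clinear \<phi> \<longrightarrow> bounded_clinear \<psi> \<longrightarrow>
        (\<forall>u. norm (tensor_lift (\<lambda>x y. \<phi> x * \<psi> y) u) \<le> onorm \<phi> * onorm \<psi> * \<alpha> u))"

definition reasonable_uniform_cross_norm ::
  "(('a::complex_banach, 'b::complex_banach) tensor \<Rightarrow> real) \<Rightarrow> bool" where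
  "reasonable_uniform_cross_norm \<alpha> \<longleftrightarrow>
     reasonable_cross_norm \<alpha> \<and>
     (\<forall>S T u. \<alpha> (tensor_map S T u) \<le> bop_norm S * bop_norm T * \<alpha> u)"

text \<open>
  The Banach space \<open>'c\<close> together with the embedding \<open>\<iota>\<close> is a completion of
  $(X \otimes Y, \alpha)$.
\<close>

definition is_completion ::
  "(('a::complex_banach, 'b::complex_banach) tensor \<Rightarrow> real) \<Rightarrow>
   (('a, 'b) tensor \<Rightarrow> 'c::complex_banach) \<Rightarrow> bool" where
  "is_completion \<alpha> \<iota> \<longleftrightarrow>
     clinear \<iota> \<and> (\<forall>u. norm (\<iota> u) = \<alpha> u) \<and> closure (range \<iota>) = UNIV"

text \<open>
  The continuous extension of $S \otimes T$ to the completion; it exists and is unique by the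
  lemma that follows.
\<close>

definition tensor_op ::
  "(('a::complex_banach, 'b::complex_banach) tensor \<Rightarrow> 'c::complex_banach) \<Rightarrow>
   'a bop \<Rightarrow> 'b bop \<Rightarrow> 'c bop" where
  "tensor_op \<iota> S T = (THE R. \<forall>u. bop_apply R (\<iota> u) = \<iota> (tensor_map S T u))"

lemma tensor_op_ex1:
  assumes \<alpha>: "reasonable_uniform_cross_norm \<alpha>" and \<iota>: "is_completion \<alpha> \<iota>"
  shows "\<exists>!R. \<forall>u. bop_apply R (\<iota> u) = \<iota> (tensor_map S T u)"
proof -
  define K where "K = bop_norm S * bop_norm T"
  have K: "0 \<le> K" by (simp add: K_def bop_norm_def)
  have lin: "\<iota> (u + v) = \<iota> u + \<iota> v" "\<iota> (c *\<^sub>C u) = c *\<^sub>C \<iota> u" for u v c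
    using \<iota> by (auto simp: is_completion_def clinear_iff)
  have tlin: "tensor_map S T (u + v) = tensor_map S T u + tensor_map S T v"
    "tensor_map S T (c *\<^sub>C u) = c *\<^sub>C tensor_map S T u" for u v c
    using clinear_tensor_map[of S T] by (auto simp: clinear_iff)
  have diff: "\<iota> (u - v) = \<iota> u - \<iota> v" for u v
    using lin(1)[of "u - v" v] by simp
  have tdiff: "tensor_map S T (u - v) = tensor_map S T u - tensor_map S T v" for u v
    using tlin(1)[of "u - v" v] by simp
  have bd: "norm (\<iota> (tensor_map S T u)) \<le> K * norm (\<iota> u)" for u
    using \<alpha> \<iota> by (simp add: reasonable_uniform_cross_norm_def is_completion_def K_def)
  have inj: "u = v" if "\<iota> u = \<iota> v" for u v
  proof -
    have "norm (\<iota> (u - v)) = 0" using that diff by simp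
    then have "\<alpha> (u - v) = 0" using \<iota> by (metis is_completion_def)
    then have "u - v = 0"
      using \<alpha> by (simp add: reasonable_uniform_cross_norm_def reasonable_cross_norm_def cnorm_def)
    then show ?thesis by simp
  qed
  define f where "f z = \<iota> (tensor_map S T (inv \<iota> z))" for z
  have f: "f (\<iota> u) = \<iota> (tensor_map S T u)" for u
    using inj by (simp add: f_def inj_def)
  have lip: "K-lipschitz_on (range \<iota>) f"
  proof (rule lipschitz_onI[OF _ K])
    fix z w assume "z \<in> range \<iota>" "w \<in> range \<iota>"
    then obtain u v where "z = \<iota> u" "w = \<iota> v" by blast
    then show "dist (f z) (f w) \<le> K * dist z w"
      using bd[of "u - v"] by (simp add: dist_norm f diff tdiff)
  qed
  obtain g where g: "uniformly_continuous_on (closure (range \<iota>)) g"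
    "\<And>z. z \<in> range \<iota> \<Longrightarrow> f z = g z"
    using uniformly_continuous_on_extension_on_closure[OF lipschitz_on_uniformly_continuous[OF lip]]
    by metis
  have dense: "closure (range \<iota>) = UNIV" using \<iota> by (simp add: is_completion_def)
  have gcont: "continuous_on UNIV g"
    using g(1) dense uniformly_continuous_imp_continuous by metis
  have gi: "g (\<iota> u) = \<iota> (tensor_map S T u)" for u using g(2)[of "\<iota> u"] f by simp
  have seq: "\<exists>s. (\<lambda>n. \<iota> (s n)) \<longlonglongrightarrow> z" for z
  proof -
    have "z \<in> closure (range \<iota>)" using dense by simp
    then obtain w where w: "\<And>n::nat. w n \<in> range \<iota>" "w \<longlonglongrightarrow> z"
      unfolding closure_sequential by blast
    from w(1) have "\<forall>n. \<exists>u. w n = \<iota> u" by blast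
    then obtain s where "\<forall>n. w n = \<iota> (s n)" by metis
    then have "w = (\<lambda>n. \<iota> (s n))" by auto
    with w(2) show ?thesis by blast
  qed
  have glim: "(\<lambda>n. g (s n)) \<longlonglongrightarrow> g z" if "s \<longlonglongrightarrow> z" for s z
    using continuous_on_tendsto_compose[OF gcont that] by simp
  have gadd: "g (x + y) = g x + g y" for x y
  proof -
    obtain s t where s: "(\<lambda>n. \<iota> (s n)) \<longlonglongrightarrow> x" and t: "(\<lambda>n. \<iota> (t n)) \<longlonglongrightarrow> y"
      using seq by metis
    have eq: "g (\<iota> (s n) + \<iota> (t n)) = g (\<iota> (s n)) + g (\<iota> (t n))" for n
      using gi[of "s n + t n"] by (simp add: gi lin tlin)
    have "(\<lambda>n. g (\<iota> (s n)) + g (\<iota> (t n))) \<longlonglongrightarrow> g (x + y)"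
      using glim[OF tendsto_add[OF s t]] by (simp add: eq)
    then show ?thesis
      using tendsto_add[OF glim[OF s] glim[OF t]] LIMSEQ_unique by blast
  qed
  have gscale: "g (c *\<^sub>C x) = c *\<^sub>C g x" for c x
  proof -
    obtain s where s: "(\<lambda>n. \<iota> (s n)) \<longlonglongrightarrow> x" using seq by metis
    have sc: "(\<lambda>n. c *\<^sub>C r n) \<longlonglongrightarrow> c *\<^sub>C a" if "r \<longlonglongrightarrow> a" for r and a :: 'c
      using bounded_linear.tendsto[OF bounded_linear_scaleC that] .
    have eq: "g (c *\<^sub>C \<iota> (s n)) = c *\<^sub>C g (\<iota> (s n))" for n
      using gi[of "c *\<^sub>C s n"] by (simp add: gi lin tlin)
    have "(\<lambda>n. c *\<^sub>C g (\<iota> (s n))) \<longlonglongrightarrow> g (c *\<^sub>C x)"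
      using glim[OF sc[OF s]] by (simp add: eq)
    then show ?thesis using sc[OF glim[OF s]] LIMSEQ_unique by blast
  qed
  have gbd: "norm (g x) \<le> norm x * K" for x
  proof -
    obtain s where s: "(\<lambda>n. \<iota> (s n)) \<longlonglongrightarrow> x" using seq by metis
    have "norm (g (\<iota> (s n))) \<le> norm (\<iota> (s n)) * K" for n
      using bd[of "s n"] by (simp add: gi mult.commute)
    then show ?thesis
      using LIMSEQ_le[OF tendsto_norm[OF glim[OF s]] tendsto_mult_right[OF tendsto_norm[OF s]]]
      by blast
  qed
  have "bounded_clinear g"
    unfolding bounded_clinear_def
    using gadd gscale gbd
    by (auto simp: clinear_iff scaleR_scaleC intro!: bounded_linear_intro[of g K])
  then obtain R where R: "bop_apply R = g" using bop_exists by blast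
  show ?thesis
  proof (rule ex1I[of _ R])
    show "\<forall>u. bop_apply R (\<iota> u) = \<iota> (tensor_map S T u)" using R gi by simp
    fix Q assume Q: "\<forall>u. bop_apply Q (\<iota> u) = \<iota> (tensor_map S T u)"
    show "Q = R"
    proof (rule bop_eqI)
      fix x
      obtain s where s: "(\<lambda>n. \<iota> (s n)) \<longlonglongrightarrow> x" using seq by metis
      have "(\<lambda>n. bop_apply Q (\<iota> (s n))) \<longlonglongrightarrow> bop_apply Q x"
        using bounded_linear.tendsto[of "bop_apply Q"] bounded_clinear_bop_apply[of Q] s
        by (auto simp: bounded_clinear_def)
      then have "(\<lambda>n. g (\<iota> (s n))) \<longlonglongrightarrow> bop_apply Q x" using Q gi by simp
      then show "bop_apply Q x = bop_apply R x"
        using glim[OF s] LIMSEQ_unique R by metis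
    qed
  qed
qed

lemma tensor_op_apply:
  assumes "reasonable_uniform_cross_norm \<alpha>" "is_completion \<alpha> \<iota>"
  shows "bop_apply (tensor_op \<iota> S T) (\<iota> u) = \<iota> (tensor_map S T u)"
  using theI'[OF tensor_op_ex1[OF assms, of S T]] unfolding tensor_op_def by blast

end

theory Submission
  imports Defs "HOL-Computational_Algebra.Fundamental_Theorem_Algebra"
begin

text \<open>
  Write $L A = S_1 A T_1$ on $B(X)$ and $M B = S_2 B T_2$ on $B(Y)$.  Then $L^k 1 = S_1^k T_1^k$, so
  that $\beta_n(S_1, T_1) = (L - 1)^n 1$ by the binomial theorem, and left $n$-inverses become
  vectors annihilated by a power of a linear map minus the identity.  The canonical map
  $B(X) \otimes B(Y) \to B(X \overline\otimes Y)$ is injective (\<open>lift_tensor_op_eq_0\<close>) and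
  intertwines $L \otimes M$ with the corresponding map for $S_1 \otimes S_2$ and $T_1 \otimes T_2$.
  Hence the norms and the completion disappear, and the claim becomes a statement about arbitrary
  linear maps $L$ on $V$ and $M$ on $W$ and nonzero vectors $v$ and $w$: when does
  $(L \otimes M - 1)^n$ annihilate $v \otimes w$?

  Suppose that it does.  Expanding the power and applying a functional $\psi$ with
  $\psi(w) \neq 0$ to the second factor shows that a nonzero polynomial in $L$ kills $v$.  So $L$
  has an eigenvector $u$, with eigenvalue $z$, among the vectors $u$ for which
  $(L \otimes M - 1)^n$ kills $u \otimes w$.  On $u \otimes W$ the map $L \otimes M$ acts as
  $z M$, which gives $(z M - 1)^n w = 0$; in particular $z \neq 0$.  The last nonzero vector
  $(z M - 1)^b w$ is an eigenvector of $M$ with eigenvalue $1 / z$, and the same argument on the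
  other side gives $(z^{-1} L - 1)^n v = 0$ (\<open>tensor_annihilated_imp_factors\<close>).

  It remains to relate the exponents.  After absorbing the scalar into $L$ and $M$, let $a$ and $b$
  be the largest exponents for which $(L - 1)^a v$ and $(M - 1)^b w$ do not vanish.  From
  $L \otimes M - 1 = (L - 1) \otimes M + 1 \otimes (M - 1)$ one finds that
  $(L \otimes M - 1)^{a + b} (v \otimes w)$ is the nonzero vector
  $\binom{a+b}{a} (L - 1)^a v \otimes (M - 1)^b w$, and that the next power vanishes
  (\<open>minus_id_tmap_order\<close>).  So the strict orders $l = a + 1$, $m = b + 1$ and $n$ satisfy
  $l + m = n + 1$ exactly, which gives the strict equivalence; the other one follows
  because every exponent above the order also annihilates.
\<close>

section \<open>Complex-linear maps\<close>

lemma clinear_module_hom: "clinear f \<Longrightarrow> module_hom scaleC scaleC f"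
  unfolding Vector_Spaces.linear_def by blast

lemmas clinear_add = module_hom.add[OF clinear_module_hom]
  and clinear_scaleC = module_hom.scale[OF clinear_module_hom]
  and clinear_0 = module_hom.zero[OF clinear_module_hom]
  and clinear_diff = module_hom.diff[OF clinear_module_hom]
  and clinear_sum = module_hom.sum[OF clinear_module_hom]

lemma clinear_funpow:
  fixes f :: "'v::complex_vector \<Rightarrow> 'v"
  shows "clinear f \<Longrightarrow> clinear (f ^^ n)"
  by (induction n) (simp_all add: clinear_iff)

lemma clinear_comp: "clinear f \<Longrightarrow> clinear g \<Longrightarrow> clinear (\<lambda>x. f (g x))"
  by (simp add: clinear_iff)

lemma clinear_scaleC_map: "clinear f \<Longrightarrow> clinear (\<lambda>x. c *\<^sub>C f x)"
  by (simp add: clinear_iff scaleC_add_right mult.commute)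

definition minus_id :: "('v::complex_vector \<Rightarrow> 'v) \<Rightarrow> 'v \<Rightarrow> 'v" where
  "minus_id f = (\<lambda>v. f v - v)"

lemma clinear_minus_id: "clinear f \<Longrightarrow> clinear (minus_id f)"
  by (simp add: clinear_iff minus_id_def complex_vector.scale_right_diff_distrib)

lemma funpow_eq_0_mono:
  fixes f :: "'v::complex_vector \<Rightarrow> 'v"
  assumes "clinear f" "(f ^^ k) v = 0" "k \<le> n"
  shows "(f ^^ n) v = 0"
proof -
  have "(f ^^ n) v = (f ^^ (n - k)) ((f ^^ k) v)"
    using assms(3) by (simp flip: funpow_add[THEN fun_cong, unfolded comp_def])
  then show ?thesis using assms clinear_0[OF clinear_funpow] by metis
qed

lemma nilpotency_order:
  fixes f :: "'v::complex_vector \<Rightarrow> 'v"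
  assumes "(f ^^ k) v = 0" "v \<noteq> 0"
  obtains a where "a < k" "(f ^^ a) v \<noteq> 0" "(f ^^ Suc a) v = 0"
proof -
  have "(LEAST j. (f ^^ j) v = 0) \<noteq> 0"
    using LeastI[of "\<lambda>j. (f ^^ j) v = 0" k] assms by (metis funpow_0)
  then obtain a where a: "(LEAST j. (f ^^ j) v = 0) = Suc a" by (metis not0_implies_Suc)
  show thesis
  proof
    show "a < k" using Least_le[of "\<lambda>j. (f ^^ j) v = 0" k] assms a by simp
    show "(f ^^ a) v \<noteq> 0" using not_less_Least[of a "\<lambda>j. (f ^^ j) v = 0"] a by simp
    show "(f ^^ Suc a) v = 0" using LeastI[of "\<lambda>j. (f ^^ j) v = 0" k] assms a by metis
  qed
qed


section \<open>Polynomials in a linear map, and eigenvectors\<close>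

definition poly_map ::
  "complex poly \<Rightarrow> ('v::complex_vector \<Rightarrow> 'v) \<Rightarrow> 'v \<Rightarrow> 'v" where
  "poly_map p f v = (\<Sum>i\<le>degree p. coeff p i *\<^sub>C (f ^^ i) v)"

text \<open>
  A bound that is independent of $p$ makes the sum additive in $p$ without a discussion of degrees.
\<close>

lemma poly_map_altdef:
  assumes "degree p \<le> N"
  shows "poly_map p f v = (\<Sum>i\<le>N. coeff p i *\<^sub>C (f ^^ i) v)"
  unfolding poly_map_def
  by (rule sum.mono_neutral_left) (use assms in \<open>auto simp: coeff_eq_0\<close>)

text \<open>
  The only case of multiplicativity of the polynomial calculus that is needed: it drives both the
  search for eigenvectors and the binomial expansion of $(f - 1)^n$.
\<close>

lemma poly_map_linear_factor:
  assumes "clinear f"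
  shows "poly_map ([:- z, 1:] * p) f v = poly_map p f (f v - z *\<^sub>C v)"
proof -
  define N where "N = degree p"
  have fN: "coeff p (Suc N) = 0" by (simp add: N_def coeff_eq_0)
  have fsub: "(f ^^ i) (f v - z *\<^sub>C v) = (f ^^ Suc i) v - z *\<^sub>C (f ^^ i) v" for i
    by (simp add: clinear_diff[OF clinear_funpow[OF assms]] clinear_scaleC[OF clinear_funpow[OF assms]]
        funpow_swap1)
  have "degree ([:- z, 1:] * p) \<le> Suc N"
    using degree_mult_le[of "[:- z, 1:]" p] by (simp add: N_def)
  then have "poly_map ([:- z, 1:] * p) f v
      = (\<Sum>i\<le>Suc N. coeff ([:- z, 1:] * p) i *\<^sub>C (f ^^ i) v)"
    by (rule poly_map_altdef)
  also have "\<dots> = (\<Sum>i\<le>Suc N. (- z * coeff p i) *\<^sub>C (f ^^ i) v)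
        + (\<Sum>i\<le>Suc N. coeff (pCons 0 p) i *\<^sub>C (f ^^ i) v)"
    unfolding sum.distrib[symmetric] scaleC_add_left[symmetric] by simp
  also have "(\<Sum>i\<le>Suc N. (- z * coeff p i) *\<^sub>C (f ^^ i) v) = (\<Sum>i\<le>N. (- z * coeff p i) *\<^sub>C (f ^^ i) v)"
    by (simp add: fN)
  also have "(\<Sum>i\<le>Suc N. coeff (pCons 0 p) i *\<^sub>C (f ^^ i) v) = (\<Sum>i\<le>N. coeff p i *\<^sub>C (f ^^ Suc i) v)"
    by (subst sum.atMost_Suc_shift) simp
  finally show ?thesis
    unfolding poly_map_def N_def[symmetric]
    by (simp only: fsub)
      (simp add: complex_vector.scale_right_diff_distrib sum_subtractf scaleC_scaleC mult.commute sum_negf)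
qed

text \<open>
  Split $p$ into linear factors and apply them to $v$ one after the other.  The result is eventually
  $0$, and the last nonzero vector on the way is an eigenvector.  All these vectors stay in any set
  that is stable under the maps $f - z$, so the eigenvector inherits whatever linear condition
  invariant under $f$ is imposed on $v$; the space itself may have infinite dimension.
\<close>

lemma eigenvector_exists:
  assumes f: "clinear f" and U: "\<And>u z. u \<in> U \<Longrightarrow> f u - z *\<^sub>C u \<in> U"
    and "v \<in> U" "v \<noteq> 0" "p \<noteq> 0" "poly_map p f v = 0"
  obtains u z where "u \<in> U" "u \<noteq> 0" "f u = z *\<^sub>C u"
proof -
  have "\<exists>u z. u \<in> U \<and> u \<noteq> 0 \<and> f u = z *\<^sub>C u"
    using assms(3-)
  proof (induction "degree p" arbitrary: p v)
    case 0
    then have "coeff p 0 \<noteq> 0" by (metis leading_coeff_0_iff)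
    with 0 show ?case by (simp add: poly_map_def)
  next
    case (Suc d)
    then obtain z where "poly p z = 0"
      using fundamental_theorem_of_algebra_alt[of p] by (metis degree_pCons_0 nat.distinct(1))
    then obtain q where p: "p = [:- z, 1:] * q" by (auto simp: poly_eq_0_iff_dvd elim: dvdE)
    then have "q \<noteq> 0" using Suc.prems by auto
    then have "d = degree q" using Suc.hyps p by (simp add: degree_mult_eq del: mult_pCons_left)
    moreover have "poly_map q f (f v - z *\<^sub>C v) = 0"
      using Suc.prems poly_map_linear_factor[OF f, of z q v] p by simp
    ultimately show ?case
      using Suc.hyps(1)[of q "f v - z *\<^sub>C v"] \<open>q \<noteq> 0\<close> U[OF Suc.prems(1)] Suc.prems
      by (cases "f v - z *\<^sub>C v = 0") auto
  qed
  then show thesis using that by blast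
qed

text \<open>
  The binomial expansion of $(f - 1)^n$, read off from the coefficients of the polynomial
  $(x - 1)^n$.
\<close>

lemma minus_id_funpow:
  assumes "clinear f"
  shows "(minus_id f ^^ n) v = (\<Sum>k\<le>n. ((-1) ^ (n - k) * of_nat (n choose k)) *\<^sub>C (f ^^ k) v)"
proof -
  have "(minus_id f ^^ n) v = poly_map ([:-1, 1:] ^ n) f v"
  proof (induction n arbitrary: v)
    case 0
    show ?case by (simp add: poly_map_def scaleC_one)
  next
    case (Suc n)
    have "(minus_id f ^^ Suc n) v = (minus_id f ^^ n) (f v - v)"
      by (simp only: funpow_Suc_right comp_apply minus_id_def[of f])
    then show ?case
      using Suc poly_map_linear_factor[OF assms, of 1 "[:-1, 1:] ^ n" v]
      by (simp add: scaleC_one del: mult_pCons_left)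
  qed
  also have "\<dots> = (\<Sum>k\<le>n. coeff ([:-1, 1:] ^ n) k *\<^sub>C (f ^^ k) v)"
    by (rule poly_map_altdef) (use degree_power_le[of "[:-1, 1::complex:]" n] in simp)
  finally show ?thesis by (simp add: coeff_linear_poly_power mult.commute)
qed


section \<open>Tensor products of linear maps\<close>

lemma clinear_tensor_eqI:
  assumes "clinear f" "clinear g" "\<And>v w. f (v \<otimes> w) = g (v \<otimes> w)"
  shows "f u = g u"
proof -
  obtain xs where "u = (\<Sum>(x, y)\<leftarrow>xs. x \<otimes> y)" using tensor_eq_sum_list by blast
  then show ?thesis
    using clinear_sum_list[OF assms(1), of tensor xs] clinear_sum_list[OF assms(2), of tensor xs]
    by (simp add: assms(3))
qed

lemma cbilinear_slice: "clinear \<phi> \<Longrightarrow> cbilinear (\<lambda>v w. \<phi> v *\<^sub>C w)"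
  by (simp add: cbilinear_def clinear_iff scaleC_add_left scaleC_add_right mult.commute
      scaleC_complex_def)

lemma cbilinear_slice': "clinear \<psi> \<Longrightarrow> cbilinear (\<lambda>v w. \<psi> w *\<^sub>C v)"
  by (simp add: cbilinear_def clinear_iff scaleC_add_left scaleC_add_right mult.commute
      scaleC_complex_def)

lemma tensor_0_left [simp]: "0 \<otimes> w = 0" and tensor_0_right [simp]: "v \<otimes> 0 = 0"
  using tensor_scaleC_left[of 0 0 w] tensor_scaleC_right[of v 0 0] by simp_all

lemma tensor_diff_left: "(v - v') \<otimes> w = v \<otimes> w - v' \<otimes> w"
  and tensor_diff_right: "v \<otimes> (w - w') = v \<otimes> w - v \<otimes> w'"
  by (metis add_diff_cancel_right' diff_add_cancel tensor_add_left)
    (metis add_diff_cancel_right' diff_add_cancel tensor_add_right)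

text \<open>
  If $v \neq 0$, a functional $\varphi$ with $\varphi(v) \neq 0$ applied to the first factor
  recovers $w$ from $v \otimes w$ up to a nonzero scalar.
\<close>

lemma tensor_eq_0_iff: "v \<otimes> w = 0 \<longleftrightarrow> v = 0 \<or> w = 0"
proof
  assume 0: "v \<otimes> w = 0"
  show "v = 0 \<or> w = 0"
  proof (rule ccontr)
    assume "\<not> (v = 0 \<or> w = 0)"
    then obtain \<phi> :: "'a \<Rightarrow> complex" where \<phi>: "clinear \<phi>" "\<phi> v \<noteq> 0" and "w \<noteq> 0"
      using clinear_separates[of v] by blast
    moreover have "tensor_lift (\<lambda>v w. \<phi> v *\<^sub>C w) (v \<otimes> w) = \<phi> v *\<^sub>C w"
      by (rule tensor_lift_tensor[OF cbilinear_slice[OF \<phi>(1)]])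
    ultimately show False
      using 0 clinear_0[OF clinear_tensor_lift[OF cbilinear_slice[OF \<phi>(1)]]]
      by (metis complex_vector.scale_eq_0_iff)
  qed
qed auto

definition tmap ::
  "('a::complex_vector \<Rightarrow> 'c::complex_vector) \<Rightarrow> ('b::complex_vector \<Rightarrow> 'd::complex_vector) \<Rightarrow>
   ('a, 'b) tensor \<Rightarrow> ('c, 'd) tensor" where
  "tmap L M = tensor_lift (\<lambda>v w. L v \<otimes> M w)"

lemma
  assumes "clinear L" "clinear M"
  shows clinear_tmap: "clinear (tmap L M)"
    and tmap_tensor: "tmap L M (v \<otimes> w) = L v \<otimes> M w"
proof -
  have "cbilinear (\<lambda>v w. L v \<otimes> M w)"
    using assms by (simp add: cbilinear_def clinear_iff tensor_add_left tensor_add_right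
        tensor_scaleC_left tensor_scaleC_right)
  then show "clinear (tmap L M)" "tmap L M (v \<otimes> w) = L v \<otimes> M w"
    unfolding tmap_def by (rule clinear_tensor_lift, rule tensor_lift_tensor)
qed

text \<open>
  By induction on the number of simple tensors that represent $u$; the hypothesis \<open>slices\<close> says
  that $(\varphi \otimes 1)\,u = 0$.  If the first term is $v \otimes w$ and
  $\varphi(v) \neq 0$, then the vanishing slice along $\varphi$ expresses $w$ as a linear combination
  of the other second factors, so that the term $v \otimes w$ can be merged into the others.
\<close>

lemma tensor_eq_0_slices:
  fixes u :: "('a::complex_vector, 'b::complex_vector) tensor" and F :: "('a \<Rightarrow> complex) set"
  assumes lin: "\<And>\<phi>. \<phi> \<in> F \<Longrightarrow> clinear \<phi>"
    and sep: "\<And>v. v \<noteq> 0 \<Longrightarrow> \<exists>\<phi>\<in>F. \<phi> v \<noteq> 0"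
    and slices: "\<And>\<phi>. \<phi> \<in> F \<Longrightarrow> tensor_lift (\<lambda>v w. \<phi> v *\<^sub>C w) u = 0"
  shows "u = 0"
proof -
  obtain xs where "u = (\<Sum>(x, y)\<leftarrow>xs. x \<otimes> y)" using tensor_eq_sum_list by blast
  then show ?thesis using slices
  proof (induction "length xs" arbitrary: xs u)
    case 0
    then show ?case by simp
  next
    case (Suc k)
    then obtain v w ys where xs: "xs = (v, w) # ys" "length ys = k"
      by (metis length_Suc_conv surj_pair)
    show ?case
    proof (cases "v = 0")
      case True
      then have "u = (\<Sum>(x, y)\<leftarrow>ys. x \<otimes> y)" using Suc.prems xs by simp
      then show ?thesis using Suc.hyps(1)[of ys] Suc.prems(2) xs by blast
    next
      case False
      then obtain \<phi> where \<phi>: "\<phi> \<in> F" "\<phi> v \<noteq> 0" using sep by blast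
      define T where "T = tensor_lift (\<lambda>v (w::'b). \<phi> v *\<^sub>C w)"
      have T: "clinear T" "\<And>x y. T (x \<otimes> y) = \<phi> x *\<^sub>C y"
        unfolding T_def using clinear_tensor_lift tensor_lift_tensor cbilinear_slice lin \<phi> by blast+
      have "T u = (\<Sum>(x, y)\<leftarrow>xs. \<phi> x *\<^sub>C y)"
        using clinear_sum_list[OF T(1), of tensor xs] Suc.prems(1) by (simp add: T(2))
      then have "\<phi> v *\<^sub>C w + (\<Sum>(x, y)\<leftarrow>ys. \<phi> x *\<^sub>C y) = 0"
        using Suc.prems(2)[OF \<phi>(1)] by (simp add: T_def xs)
      then have "v \<otimes> (\<phi> v *\<^sub>C w + (\<Sum>(x, y)\<leftarrow>ys. \<phi> x *\<^sub>C y)) = 0" by simp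
      moreover have "v \<otimes> (\<Sum>(x, y)\<leftarrow>ys. \<phi> x *\<^sub>C y) = (\<Sum>(x, y)\<leftarrow>ys. (\<phi> x *\<^sub>C v) \<otimes> y)"
        by (induction ys)
          (auto simp: tensor_add_right tensor_scaleC_left tensor_scaleC_right)
      \<comment> \<open>Solve the slice equation, tensored with $v$ on the left, for $v \otimes w$.\<close>
      ultimately have "\<phi> v *\<^sub>C (v \<otimes> w) = - (\<Sum>(x, y)\<leftarrow>ys. (\<phi> x *\<^sub>C v) \<otimes> y)"
        by (simp add: tensor_add_right tensor_scaleC_right eq_neg_iff_add_eq_0)
      then have "(1 / \<phi> v) *\<^sub>C \<phi> v *\<^sub>C (v \<otimes> w)
          = (1 / \<phi> v) *\<^sub>C - (\<Sum>(x, y)\<leftarrow>ys. (\<phi> x *\<^sub>C v) \<otimes> y)" by simp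
      moreover have "(1 / \<phi> v) *\<^sub>C - (\<Sum>(x, y)\<leftarrow>ys. (\<phi> x *\<^sub>C v) \<otimes> y)
          = - (\<Sum>(x, y)\<leftarrow>ys. ((\<phi> x / \<phi> v) *\<^sub>C v) \<otimes> y)"
        by (induction ys) (auto simp: scaleC_add_right tensor_scaleC_left scaleC_scaleC
            complex_vector.scale_right_diff_distrib)
      ultimately have "v \<otimes> w = - (\<Sum>(x, y)\<leftarrow>ys. ((\<phi> x / \<phi> v) *\<^sub>C v) \<otimes> y)"
        using \<phi>(2) by (simp add: scaleC_scaleC scaleC_one)
      then have "u = (\<Sum>(x, y)\<leftarrow>ys. x \<otimes> y) - (\<Sum>(x, y)\<leftarrow>ys. ((\<phi> x / \<phi> v) *\<^sub>C v) \<otimes> y)"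
        using Suc.prems(1) xs by simp
      also have "\<dots> = (\<Sum>(x, y)\<leftarrow>map (\<lambda>(x, y). (x - (\<phi> x / \<phi> v) *\<^sub>C v, y)) ys. x \<otimes> y)"
        by (induction ys) (auto simp: tensor_diff_left algebra_simps)
      finally show ?thesis
        using Suc.hyps(1)[OF _ _ Suc.prems(2)] xs(2) by (metis length_map)
    qed
  qed
qed


section \<open>Unipotent tensor products\<close>

context
  fixes L :: "'v::complex_vector \<Rightarrow> 'v" and M :: "'w::complex_vector \<Rightarrow> 'w"
  assumes L: "clinear L" and M: "clinear M"
begin

text \<open>
  The identity $L \otimes M - 1 = (L - 1) \otimes M + 1 \otimes (M - 1)$.  The factor $M$ in the
  first summand becomes harmless on vectors killed by $M - 1$.
\<close>

lemma minus_id_tmap_tensor: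
  "minus_id (tmap L M) (v \<otimes> w) = minus_id L v \<otimes> M w + v \<otimes> minus_id M w"
  by (simp add: minus_id_def tmap_tensor L M tensor_diff_left tensor_diff_right)

lemma minus_id_tmap_funpow_commute:
  assumes P: "clinear P" and Q: "clinear Q"
    and "\<And>v. P (L v) = L (P v)" "\<And>w. Q (M w) = M (Q w)"
  shows "tmap P Q ((minus_id (tmap L M) ^^ n) u) = (minus_id (tmap L M) ^^ n) (tmap P Q u)"
proof (induction n)
  case (Suc n)
  have "tmap P Q (tmap L M t) = tmap L M (tmap P Q t)" for t
    by (rule clinear_tensor_eqI)
      (simp_all add: clinear_comp clinear_tmap tmap_tensor L M assms)
  then have "tmap P Q (minus_id (tmap L M) t) = minus_id (tmap L M) (tmap P Q t)" for t
    by (simp add: minus_id_def clinear_diff[OF clinear_tmap[OF P Q]])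
  with Suc show ?case by simp
qed simp

text \<open>
  Of the binomial expansion of $((L - 1) \otimes M + 1 \otimes (M - 1))^{a + b}$ only the term with
  exponents exactly $a$ and $b$ survives on $v \otimes w$, and there $M$ acts as the identity.  The
  induction uses Pascal's rule for the two summands \<open>1\<close> and \<open>2\<close>.
\<close>

lemma minus_id_tmap_top_power:
  assumes "(minus_id L ^^ Suc a) v = 0" "(minus_id M ^^ Suc b) w = 0"
  shows "(minus_id (tmap L M) ^^ (a + b)) (v \<otimes> w)
    = of_nat ((a + b) choose a) *\<^sub>C ((minus_id L ^^ a) v \<otimes> (minus_id M ^^ b) w)"
  using assms
proof (induction "a + b" arbitrary: a b v w)
  case 0
  then show ?case by (simp add: scaleC_one)
next
  case (Suc k)
  let ?D = "minus_id (tmap L M)" and ?A = "minus_id L" and ?B = "minus_id M"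
  note lin = clinear_funpow[OF clinear_minus_id[OF clinear_tmap[OF L M]]]
    clinear_funpow[OF clinear_minus_id[OF M]]
  \<comment> \<open>$M = 1 + (M - 1)$, so replacing $w$ by $M w$ changes \<open>(?B ^^ j) w\<close> only by the next power.\<close>
  have BM: "(?B ^^ j) (M w) = (?B ^^ j) w + (?B ^^ Suc j) w" for j
    using clinear_add[OF lin(2), of j w "?B w"] 
    by (simp only: funpow_Suc_right comp_apply) (simp add: minus_id_def[of M])
  have 1: "(?D ^^ k) (?A v \<otimes> M w)
      = (if a = 0 then 0 else of_nat (k choose (a - 1)) *\<^sub>C ((?A ^^ a) v \<otimes> (?B ^^ b) w))"
  proof (cases a)
    case 0
    then show ?thesis using Suc.prems clinear_0[OF lin(1)] by simp
  next
    case (Suc a')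
    have "(?B ^^ Suc b) (M w) = 0"
      using BM[of "Suc b"] Suc.prems(2) clinear_0[OF clinear_minus_id[OF M]] by simp
    moreover have "(?A ^^ Suc a') (?A v) = 0"
      using Suc.prems(1) Suc by (simp add: funpow_swap1)
    ultimately show ?thesis
      using Suc.hyps(1)[of a' b "?A v" "M w"] Suc.hyps(2) Suc BM[of b] Suc.prems(2)
      by (simp add: funpow_swap1)
  qed
  have 2: "(?D ^^ k) (v \<otimes> ?B w)
      = (if b = 0 then 0 else of_nat (k choose a) *\<^sub>C ((?A ^^ a) v \<otimes> (?B ^^ b) w))"
  proof (cases b)
    case 0
    then show ?thesis using Suc.prems clinear_0[OF lin(1)] by simp
  next
    case (Suc b')
    have "(?B ^^ Suc b') (?B w) = 0"
      using Suc.prems(2) Suc by (simp add: funpow_swap1)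
    then show ?thesis
      using Suc.hyps(1)[of a b' v "?B w"] Suc.hyps(2) Suc Suc.prems(1)
      by (simp add: funpow_swap1)
  qed
  have "(?D ^^ (a + b)) (v \<otimes> w) = (?D ^^ k) (?A v \<otimes> M w) + (?D ^^ k) (v \<otimes> ?B w)"
    using clinear_add[OF lin(1)] by (simp flip: Suc.hyps(2) add: funpow_swap1 minus_id_tmap_tensor)
  also have "\<dots> = of_nat ((a + b) choose a) *\<^sub>C ((?A ^^ a) v \<otimes> (?B ^^ b) w)"
    using Suc.hyps(2) unfolding 1 2
    by (cases a; cases b) (auto simp: scaleC_add_left simp flip: Suc.hyps(2))
  finally show ?case .
qed

text \<open>
  Nilpotency orders of $L - 1$ at $v$ and $M - 1$ at $w$ add up, minus one.  That the order is not
  smaller depends on characteristic $0$: the binomial coefficient must not vanish.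
\<close>

lemma minus_id_tmap_order:
  assumes a: "(minus_id L ^^ a) v \<noteq> 0" "(minus_id L ^^ Suc a) v = 0"
    and b: "(minus_id M ^^ b) w \<noteq> 0" "(minus_id M ^^ Suc b) w = 0"
  shows "(minus_id (tmap L M) ^^ n) (v \<otimes> w) = 0 \<longleftrightarrow> a + b < n"
proof -
  let ?D = "minus_id (tmap L M)" and ?t = "(minus_id L ^^ a) v \<otimes> (minus_id M ^^ b) w"
  note D = clinear_minus_id[OF clinear_tmap[OF L M]]
  have eq: "(?D ^^ (a + b)) (v \<otimes> w) = of_nat ((a + b) choose a) *\<^sub>C ?t"
    by (rule minus_id_tmap_top_power) (fact a(2) b(2))+
  have "(?D ^^ (a + b)) (v \<otimes> w) \<noteq> 0"
    using a(1) b(1) by (simp add: eq tensor_eq_0_iff)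
  moreover have "?D ?t = 0"
    using a(2) b(2) by (simp add: minus_id_tmap_tensor)
  then have "(?D ^^ Suc (a + b)) (v \<otimes> w) = 0"
    by (simp add: eq clinear_scaleC[OF D])
  ultimately show ?thesis
    using funpow_eq_0_mono[OF D] by (metis Suc_leI not_less)
qed

lemma minus_id_tmap_eigenvector_left:
  assumes "L u = z *\<^sub>C u"
  shows "(minus_id (tmap L M) ^^ n) (u \<otimes> w) = u \<otimes> (minus_id (\<lambda>w. z *\<^sub>C M w) ^^ n) w"
  by (induction n)
    (simp_all add: assms minus_id_def tmap_tensor L M tensor_diff_right tensor_scaleC_left
      tensor_scaleC_right)

lemma minus_id_tmap_eigenvector_right:
  assumes "M u = z *\<^sub>C u"
  shows "(minus_id (tmap L M) ^^ n) (v \<otimes> u) = (minus_id (\<lambda>v. z *\<^sub>C L v) ^^ n) v \<otimes> u"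
  by (induction n)
    (simp_all add: assms minus_id_def tmap_tensor L M tensor_diff_left tensor_scaleC_left
      tensor_scaleC_right)

text \<open>
  The vectors $v'$ with $(L \otimes M - 1)^n (v' \otimes w) = 0$ form a subspace that is invariant
  under $L$, because $L \otimes 1$ commutes with $L \otimes M$.  On it, $L$ is algebraic at $v$: slicing
  $(L \otimes M - 1)^n (v \otimes w)$ with a functional $\psi$ yields a polynomial in $L$ whose
  constant coefficient is $(-1)^n \psi(w) \neq 0$.
\<close>

lemma tensor_annihilated_imp_eigenvector:
  assumes "v \<noteq> 0" "w \<noteq> 0" and 0: "(minus_id (tmap L M) ^^ n) (v \<otimes> w) = 0"
  obtains u z where "u \<noteq> 0" "L u = z *\<^sub>C u" "(minus_id (tmap L M) ^^ n) (u \<otimes> w) = 0"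
proof -
  let ?D = "minus_id (tmap L M)"
  note D = clinear_funpow[OF clinear_minus_id[OF clinear_tmap[OF L M]], of n]
  define U where "U = {v'. (?D ^^ n) (v' \<otimes> w) = 0}"
  have U: "L u - z *\<^sub>C u \<in> U" if "u \<in> U" for u z
  proof -
    have "(?D ^^ n) (tmap L (\<lambda>w. w) (u \<otimes> w)) = tmap L (\<lambda>w. w) ((?D ^^ n) (u \<otimes> w))"
      by (rule minus_id_tmap_funpow_commute[symmetric]) (simp_all add: L clinear_iff[of "\<lambda>w. w"])
    also have "\<dots> = 0"
      using that clinear_0[OF clinear_tmap[of L "\<lambda>w. w"]] L by (simp add: U_def clinear_iff)
    finally have "(?D ^^ n) (L u \<otimes> w) = 0" by (simp add: tmap_tensor L clinear_iff[of "\<lambda>w. w"])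
    then show ?thesis
      using that by (simp add: U_def tensor_diff_left tensor_scaleC_left clinear_diff[OF D]
          clinear_scaleC[OF D])
  qed
  obtain \<psi> :: "'w \<Rightarrow> complex" where \<psi>: "clinear \<psi>" "\<psi> w \<noteq> 0"
    using clinear_separates \<open>w \<noteq> 0\<close> by blast
  define c where "c k = (-1) ^ (n - k) * of_nat (n choose k) * \<psi> ((M ^^ k) w)" for k
  define p where "p = (\<Sum>k\<le>n. monom (c k) k)"
  have cp: "coeff p k = (if k \<le> n then c k else 0)" for k
    by (simp add: p_def coeff_sum)
  have G: "(tmap L M ^^ k) (v \<otimes> w) = (L ^^ k) v \<otimes> (M ^^ k) w" for k
    by (induction k) (simp_all add: tmap_tensor L M)
  define T where "T = tensor_lift (\<lambda>(v::'v) w. \<psi> w *\<^sub>C v)"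
  have T: "clinear T" "\<And>x y. T (x \<otimes> y) = \<psi> y *\<^sub>C x"
    unfolding T_def using clinear_tensor_lift tensor_lift_tensor cbilinear_slice' \<psi> by blast+
  have "poly_map p L v = (\<Sum>k\<le>n. c k *\<^sub>C (L ^^ k) v)"
    by (subst poly_map_altdef[of p n]) (auto intro!: degree_le simp: cp)
  also have "\<dots> = T ((?D ^^ n) (v \<otimes> w))"
    by (simp add: minus_id_funpow[OF clinear_tmap[OF L M]] clinear_sum[OF T(1)]
        clinear_scaleC[OF T(1)] G T(2) c_def)
  also have "\<dots> = 0" using 0 clinear_0[OF T(1)] by simp
  finally have "poly_map p L v = 0" .
  moreover have "coeff p 0 \<noteq> 0" using \<psi>(2) by (simp add: cp c_def)
  then have "p \<noteq> 0" by auto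
  moreover have "v \<in> U" using 0 by (simp add: U_def)
  ultimately show thesis
    using eigenvector_exists[OF L U, of v p] \<open>v \<noteq> 0\<close> that by (auto simp: U_def)
qed

text \<open>
  An eigenvector of $L$ transfers the annihilation to the single factor $w$.  This already produces
  an eigenvector $y$ of $M$, the last nonzero iterate of $w$, which transfers it back to $v$ with the
  inverse scalar.
\<close>

lemma tensor_annihilated_imp_factors:
  assumes "v \<noteq> 0" "w \<noteq> 0" and 0: "(minus_id (tmap L M) ^^ n) (v \<otimes> w) = 0"
  obtains z where "z \<noteq> 0" "(minus_id (\<lambda>v. z *\<^sub>C L v) ^^ n) v = 0"
    "(minus_id (\<lambda>w. (1 / z) *\<^sub>C M w) ^^ n) w = 0"
proof -
  let ?D = "minus_id (tmap L M)"
  obtain u z where u: "u \<noteq> 0" "L u = z *\<^sub>C u" "(?D ^^ n) (u \<otimes> w) = 0"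
    using tensor_annihilated_imp_eigenvector[OF assms] .
  define B where "B = minus_id (\<lambda>w. z *\<^sub>C M w)"
  have B: "clinear B" unfolding B_def by (intro clinear_minus_id clinear_scaleC_map M)
  have Bn: "(B ^^ n) w = 0"
    using u by (simp add: minus_id_tmap_eigenvector_left B_def tensor_eq_0_iff)
  then obtain b where b: "(B ^^ b) w \<noteq> 0" "(B ^^ Suc b) w = 0"
    using nilpotency_order[of n B w] \<open>w \<noteq> 0\<close> by metis
  define y where "y = (B ^^ b) w"
  have y: "y \<noteq> 0" "z *\<^sub>C M y = y" using b by (simp_all add: y_def B_def minus_id_def)
  then have "z \<noteq> 0" by auto
  then have My: "M y = (1 / z) *\<^sub>C y"
    using arg_cong[OF y(2), of "scaleC (1 / z)"] by (simp add: scaleC_scaleC scaleC_one)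
  have BM: "(B ^^ b) (M x) = M ((B ^^ b) x)" for x
    by (induction b) (simp_all add: B_def minus_id_def clinear_diff[OF M] clinear_scaleC[OF M])
  have idlin: "clinear (\<lambda>x::'v. x)" by (simp add: clinear_iff)
  have "(?D ^^ n) (v \<otimes> y) = (?D ^^ n) (tmap (\<lambda>x. x) (B ^^ b) (v \<otimes> w))"
    by (simp add: y_def tmap_tensor idlin clinear_funpow B)
  also have "\<dots> = tmap (\<lambda>x. x) (B ^^ b) ((?D ^^ n) (v \<otimes> w))"
    by (rule minus_id_tmap_funpow_commute[symmetric]) (simp_all add: idlin clinear_funpow B BM)
  also have "\<dots> = 0"
    using 0 clinear_0[OF clinear_tmap[OF idlin clinear_funpow[OF B]]] by simp
  finally have "(minus_id (\<lambda>v. (1 / z) *\<^sub>C L v) ^^ n) v = 0"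
    using y(1) by (simp add: minus_id_tmap_eigenvector_right My tensor_eq_0_iff)
  then show thesis
    using that[of "1 / z"] \<open>z \<noteq> 0\<close> Bn by (simp add: B_def)
qed

lemma tmap_rescale:
  assumes "z \<noteq> 0"
  shows "tmap (\<lambda>v. z *\<^sub>C L v) (\<lambda>w. (1 / z) *\<^sub>C M w) = tmap L M"
proof
  fix u
  show "tmap (\<lambda>v. z *\<^sub>C L v) (\<lambda>w. (1 / z) *\<^sub>C M w) u = tmap L M u"
    by (rule clinear_tensor_eqI)
      (simp_all add: clinear_tmap tmap_tensor L M clinear_scaleC_map tensor_scaleC_left
        tensor_scaleC_right scaleC_scaleC scaleC_one assms)
qed

end

text \<open>
  Once a scalar $z$ has been found, the exact orders $a + 1$ and $b + 1$ for $z L$ and $z^{-1} M$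
  decide everything, since $L \otimes M = z L \otimes z^{-1} M$.  The applications have
  $v = 1 \in B(X)$ and $w = 1 \in B(Y)$.
\<close>

theorem tensor_annihilated_iff:
  fixes L :: "'v::complex_vector \<Rightarrow> 'v" and M :: "'w::complex_vector \<Rightarrow> 'w"
  assumes L: "clinear L" and M: "clinear M" and nz: "v \<noteq> 0" "w \<noteq> 0" and "n \<ge> 1"
  shows "(minus_id (tmap L M) ^^ n) (v \<otimes> w) = 0 \<longleftrightarrow>
      (\<exists>l m z. l \<ge> 1 \<and> m \<ge> 1 \<and> l + m = n + 1 \<and> z \<noteq> 0 \<and>
        (minus_id (\<lambda>v. z *\<^sub>C L v) ^^ l) v = 0 \<and> (minus_id (\<lambda>w. (1 / z) *\<^sub>C M w) ^^ m) w = 0)"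
    (is "?D n = 0 \<longleftrightarrow> ?R")
    and "(minus_id (tmap L M) ^^ n) (v \<otimes> w) = 0 \<and>
        (minus_id (tmap L M) ^^ (n - 1)) (v \<otimes> w) \<noteq> 0 \<longleftrightarrow>
      (\<exists>l m z. l \<ge> 1 \<and> m \<ge> 1 \<and> l + m = n + 1 \<and> z \<noteq> 0 \<and>
        ((minus_id (\<lambda>v. z *\<^sub>C L v) ^^ l) v = 0 \<and> (minus_id (\<lambda>v. z *\<^sub>C L v) ^^ (l - 1)) v \<noteq> 0) \<and>
        ((minus_id (\<lambda>w. (1 / z) *\<^sub>C M w) ^^ m) w = 0 \<and>
         (minus_id (\<lambda>w. (1 / z) *\<^sub>C M w) ^^ (m - 1)) w \<noteq> 0))"
    (is "_ \<longleftrightarrow> ?R'")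
proof -
  let ?A = "\<lambda>z. minus_id (\<lambda>v. z *\<^sub>C L v)" and ?B = "\<lambda>z. minus_id (\<lambda>w. (1 / z) *\<^sub>C M w)"
  have order: "?D k = 0 \<longleftrightarrow> a + b < k"
    if "z \<noteq> 0" "(?A z ^^ a) v \<noteq> 0" "(?A z ^^ Suc a) v = 0" "(?B z ^^ b) w \<noteq> 0"
      "(?B z ^^ Suc b) w = 0" for z a b k
    using minus_id_tmap_order[where L = "\<lambda>v. z *\<^sub>C L v" and M = "\<lambda>w. (1 / z) *\<^sub>C M w",
        OF _ _ that(2-5)]
    by (simp add: clinear_scaleC_map L M tmap_rescale[OF L M that(1)])
  have ex: "\<exists>z a b. z \<noteq> 0 \<and> (?A z ^^ a) v \<noteq> 0 \<and> (?A z ^^ Suc a) v = 0 \<and>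
      (?B z ^^ b) w \<noteq> 0 \<and> (?B z ^^ Suc b) w = 0" if D: "?D n = 0"
  proof -
    obtain z where z: "z \<noteq> 0" "(?A z ^^ n) v = 0" "(?B z ^^ n) w = 0"
      by (rule tensor_annihilated_imp_factors[OF L M nz D])
    then show ?thesis
      using nilpotency_order[OF z(2) nz(1)] nilpotency_order[OF z(3) nz(2)] by metis
  qed
  show "?D n = 0 \<longleftrightarrow> ?R"
  proof
    assume D: "?D n = 0"
    obtain z a b where zab: "z \<noteq> 0" "(?A z ^^ a) v \<noteq> 0" "(?A z ^^ Suc a) v = 0"
      "(?B z ^^ b) w \<noteq> 0" "(?B z ^^ Suc b) w = 0" using ex[OF D] by blast
    then have "a + b < n" using order D by blast
    \<comment> \<open>The slack $n - (a + b + 1)$ is put into the exponent of the second factor.\<close>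
    moreover from this have "(?B z ^^ (n - a)) w = 0"
      using funpow_eq_0_mono[OF clinear_minus_id[OF clinear_scaleC_map[OF M]] zab(5)] by simp
    ultimately show ?R
      using zab by (intro exI[of _ "Suc a"] exI[of _ "n - a"] exI[of _ z]) simp
  next
    assume ?R
    then obtain l m z where lmz: "l + m = n + 1" "z \<noteq> 0" "(?A z ^^ l) v = 0" "(?B z ^^ m) w = 0"
      by blast
    obtain a where a: "a < l" "(?A z ^^ a) v \<noteq> 0" "(?A z ^^ Suc a) v = 0"
      by (rule nilpotency_order[OF lmz(3) nz(1)])
    obtain b where b: "b < m" "(?B z ^^ b) w \<noteq> 0" "(?B z ^^ Suc b) w = 0"
      by (rule nilpotency_order[OF lmz(4) nz(2)])
    show "?D n = 0"
      using order[OF lmz(2) a(2,3) b(2,3), of n] a(1) b(1) lmz(1) by linarith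
  qed
  show "?D n = 0 \<and> ?D (n - 1) \<noteq> 0 \<longleftrightarrow> ?R'"
  proof
    assume D: "?D n = 0 \<and> ?D (n - 1) \<noteq> 0"
    then obtain z a b where zab: "z \<noteq> 0" "(?A z ^^ a) v \<noteq> 0" "(?A z ^^ Suc a) v = 0"
      "(?B z ^^ b) w \<noteq> 0" "(?B z ^^ Suc b) w = 0" using ex by blast
    then have "a + b < n" "\<not> a + b < n - 1" using order D by blast+
    \<comment> \<open>Both bounds together force $a + b = n - 1$.\<close>
    then show ?R'
      using zab by (intro exI[of _ "Suc a"] exI[of _ "Suc b"] exI[of _ z]) simp
  next
    assume ?R'
    then obtain l m z where lmz: "l \<ge> 1" "m \<ge> 1" "l + m = n + 1" "z \<noteq> 0"
      "(?A z ^^ l) v = 0" "(?A z ^^ (l - 1)) v \<noteq> 0"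
      "(?B z ^^ m) w = 0" "(?B z ^^ (m - 1)) w \<noteq> 0" by blast
    then have "?D k = 0 \<longleftrightarrow> (l - 1) + (m - 1) < k" for k
      using order[of z "l - 1" "m - 1"] by simp
    then show "?D n = 0 \<and> ?D (n - 1) \<noteq> 0" using lmz(1-3) by auto
  qed
qed


section \<open>The algebra \<open>B(X)\<close> and the completed tensor product\<close>

lemma clinear_sandwich: "clinear (\<lambda>A::'a::complex_unital_algebra. S * A * T)"
  by (simp add: clinear_iff distrib_left distrib_right mult_scaleC_left mult_scaleC_right)

lemma sandwich_funpow:
  fixes S T :: "'a::complex_unital_algebra"
  shows "((\<lambda>A. S * A * T) ^^ k) 1 = S ^ k * T ^ k"
  by (induction k) (simp_all add: mult.assoc power_commutes)

lemma beta_eq: "beta n S T = (minus_id (\<lambda>A. S * A * T) ^^ n) 1"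
  unfolding minus_id_funpow[OF clinear_sandwich]
  by (simp add: beta_def sandwich_funpow atMost_atLeast0)

lemma clinear_bop_eval: "clinear (\<lambda>A. bop_apply A x)"
  by (simp add: clinear_iff bop_apply_simps)

context
  fixes \<alpha> :: "('x::complex_banach, 'y::complex_banach) tensor \<Rightarrow> real"
    and \<iota> :: "('x, 'y) tensor \<Rightarrow> 'z::complex_banach"
  assumes \<alpha>: "reasonable_uniform_cross_norm \<alpha>" and \<iota>: "is_completion \<alpha> \<iota>"
begin

lemma tensor_op_eqI: "\<forall>u. bop_apply R (\<iota> u) = \<iota> (tensor_map S T u) \<Longrightarrow> tensor_op \<iota> S T = R"
  using tensor_op_ex1[OF \<alpha> \<iota>, of S T] tensor_op_apply[OF \<alpha> \<iota>, of S T] by blast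

lemma clinear_\<iota>: "clinear \<iota>"
  using \<iota> by (simp add: is_completion_def)

text \<open>
  To identify an operator with $S \otimes T$ it is enough to know a linear map $f$ that it induces
  on the algebraic tensor product and the values of $f$ at simple tensors.
\<close>

lemma tensor_op_intro:
  assumes "clinear f" "\<And>u. bop_apply R (\<iota> u) = \<iota> (f u)"
    "\<And>x y. f (x \<otimes> y) = bop_apply S x \<otimes> bop_apply T y"
  shows "tensor_op \<iota> S T = R"
proof (rule tensor_op_eqI)
  have "f u = tensor_map S T u" for u
    by (rule clinear_tensor_eqI[OF assms(1) clinear_tensor_map]) (simp add: assms(3) tensor_map_tensor)
  then show "\<forall>u. bop_apply R (\<iota> u) = \<iota> (tensor_map S T u)" by (simp add: assms(2))
qed

lemma tensor_op_mult: "tensor_op \<iota> (S * S') (T * T') = tensor_op \<iota> S T * tensor_op \<iota> S' T'"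
  by (rule tensor_op_intro[where f = "\<lambda>u. tensor_map S T (tensor_map S' T' u)"])
    (simp_all add: clinear_comp clinear_tensor_map bop_apply_simps tensor_op_apply[OF \<alpha> \<iota>]
      tensor_map_tensor)

lemma tensor_op_one: "tensor_op \<iota> 1 1 = 1"
  by (rule tensor_op_intro[where f = "\<lambda>u. u"]) (simp_all add: clinear_iff bop_apply_simps)

lemma cbilinear_tensor_op: "cbilinear (tensor_op \<iota>)"
proof -
  note lin = clinear_tensor_map[unfolded clinear_iff]
  have "tensor_op \<iota> S (T + T') = tensor_op \<iota> S T + tensor_op \<iota> S T'" for S T T'
    by (rule tensor_op_intro[where f = "\<lambda>u. tensor_map S T u + tensor_map S T' u"])
      (simp_all add: clinear_iff lin scaleC_add_right bop_apply_simps tensor_op_apply[OF \<alpha> \<iota>]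
        clinear_add[OF clinear_\<iota>] tensor_map_tensor tensor_add_right)
  moreover have "tensor_op \<iota> (S + S') T = tensor_op \<iota> S T + tensor_op \<iota> S' T" for S S' T
    by (rule tensor_op_intro[where f = "\<lambda>u. tensor_map S T u + tensor_map S' T u"])
      (simp_all add: clinear_iff lin scaleC_add_right bop_apply_simps tensor_op_apply[OF \<alpha> \<iota>]
        clinear_add[OF clinear_\<iota>] tensor_map_tensor tensor_add_left)
  moreover have "tensor_op \<iota> S (c *\<^sub>C T) = c *\<^sub>C tensor_op \<iota> S T" for S T c
    by (rule tensor_op_intro[where f = "\<lambda>u. c *\<^sub>C tensor_map S T u"])
      (simp_all add: clinear_scaleC_map clinear_tensor_map bop_apply_simps tensor_op_apply[OF \<alpha> \<iota>]
        clinear_scaleC[OF clinear_\<iota>] tensor_map_tensor tensor_scaleC_right)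
  moreover have "tensor_op \<iota> (c *\<^sub>C S) T = c *\<^sub>C tensor_op \<iota> S T" for S T c
    by (rule tensor_op_intro[where f = "\<lambda>u. c *\<^sub>C tensor_map S T u"])
      (simp_all add: clinear_scaleC_map clinear_tensor_map bop_apply_simps tensor_op_apply[OF \<alpha> \<iota>]
        clinear_scaleC[OF clinear_\<iota>] tensor_map_tensor tensor_scaleC_left)
  ultimately show ?thesis by (simp add: cbilinear_def clinear_iff)
qed

lemmas clinear_lift_tensor_op = clinear_tensor_lift[OF cbilinear_tensor_op]
  and lift_tensor_op_tensor = tensor_lift_tensor[OF cbilinear_tensor_op]

lemma \<iota>_eq_0_iff: "\<iota> u = 0 \<longleftrightarrow> u = 0"
proof -
  have "norm (\<iota> u) = \<alpha> u" using \<iota> by (simp add: is_completion_def)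
  then show ?thesis
    using \<alpha> unfolding reasonable_uniform_cross_norm_def reasonable_cross_norm_def cnorm_def
    by (metis norm_eq_zero)
qed

text \<open>
  Injectivity of the canonical map $B(X) \otimes B(Y) \to B(X \overline\otimes Y)$.  If $u$ is sent to
  $0$, then evaluating at $x \otimes y$ shows that the image of $u$ in $X \otimes Y$ under evaluation
  of the factors at $x$ and $y$ is $0$.  Applying a functional $\varphi$ on $X$ to that image gives the
  value at $y$ of the slice of $u$ along $A \mapsto \varphi(A x)$.  So all these slices vanish, and
  the functionals $A \mapsto \varphi(A x)$ separate points of $B(X)$.
\<close>

lemma lift_tensor_op_eq_0:
  assumes 0: "tensor_lift (tensor_op \<iota>) u = 0"
  shows "u = 0"
proof (rule tensor_eq_0_slices)
  let ?F = "{\<lambda>A :: 'x bop. \<phi> (bop_apply A x) | (\<phi> :: 'x \<Rightarrow> complex) x. clinear \<phi>}"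
  fix \<phi>' assume "\<phi>' \<in> ?F"
  then obtain \<phi> :: "'x \<Rightarrow> complex" and x where \<phi>: "clinear \<phi>"
    and \<phi>': "\<phi>' = (\<lambda>A. \<phi> (bop_apply A x))" by blast
  show lin: "clinear \<phi>'"
    using \<phi> by (simp add: \<phi>' clinear_iff bop_apply_simps)
  show "tensor_lift (\<lambda>A B. \<phi>' A *\<^sub>C B) u = 0"
  proof (rule bop_eqI)
    fix y :: 'y
    let ?ev = "tmap (\<lambda>A. bop_apply A x) (\<lambda>B. bop_apply B y)"
    let ?s = "tensor_lift (\<lambda>x (y::'y). \<phi> x *\<^sub>C y)"
      and ?s' = "tensor_lift (\<lambda>A (B::'y bop). \<phi>' A *\<^sub>C B)"
    have "\<iota> (?ev u) = bop_apply (tensor_lift (tensor_op \<iota>) u) (\<iota> (x \<otimes> y))"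
      by (rule clinear_tensor_eqI[OF
            clinear_comp[OF clinear_\<iota> clinear_tmap[OF clinear_bop_eval clinear_bop_eval]]
            clinear_comp[OF clinear_bop_eval clinear_lift_tensor_op]])
        (simp add: tmap_tensor clinear_bop_eval lift_tensor_op_tensor tensor_op_apply[OF \<alpha> \<iota>]
          tensor_map_tensor)
    then have ev0: "?ev u = 0" by (simp add: 0 bop_apply_simps \<iota>_eq_0_iff)
    note s = clinear_tensor_lift[OF cbilinear_slice[OF \<phi>]]
      and s' = clinear_tensor_lift[OF cbilinear_slice[OF lin]]
    have "bop_apply (?s' u) y = ?s (?ev u)"
      by (rule clinear_tensor_eqI[OF clinear_comp[OF clinear_bop_eval s']
            clinear_comp[OF s clinear_tmap[OF clinear_bop_eval clinear_bop_eval]]])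
        (simp add: tmap_tensor clinear_bop_eval tensor_lift_tensor[OF cbilinear_slice[OF \<phi>]]
          tensor_lift_tensor[OF cbilinear_slice[OF lin]] bop_apply_simps, simp add: \<phi>')
    then show "bop_apply (?s' u) y = bop_apply 0 y"
      by (simp add: ev0 clinear_0[OF s] bop_apply_simps)
  qed
next
  fix A :: "'x bop" assume "A \<noteq> 0"
  then obtain x where "bop_apply A x \<noteq> 0" using bop_eqI[of A 0] by (auto simp: bop_apply_simps)
  then obtain \<phi> :: "'x \<Rightarrow> complex" where \<phi>: "clinear \<phi>" "\<phi> (bop_apply A x) \<noteq> 0"
    using clinear_separates by blast
  show "\<exists>\<phi>\<in>{\<lambda>A. \<phi> (bop_apply A x) | (\<phi> :: 'x \<Rightarrow> complex) x. clinear \<phi>}. \<phi> A \<noteq> 0"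
    by (rule bexI[of _ "\<lambda>A. \<phi> (bop_apply A x)"], fact \<phi>(2))
      (rule CollectI, intro exI conjI, rule refl, fact \<phi>(1))
qed

text \<open>
  The canonical map sends $1 \otimes 1$ to $1$ and intertwines the two maps $A \mapsto S A T$, so by
  injectivity nothing is lost by computing in the algebraic tensor product $B(X) \otimes B(Y)$.
\<close>

lemma beta_tensor_op_eq_0_iff:
  "beta n (tensor_op \<iota> S1 S2) (tensor_op \<iota> T1 T2) = 0 \<longleftrightarrow>
    (minus_id (tmap (\<lambda>A. S1 * A * T1) (\<lambda>B. S2 * B * T2)) ^^ n) (1 \<otimes> 1) = 0"
proof -
  let ?G = "tmap (\<lambda>A. S1 * A * T1) (\<lambda>B. S2 * B * T2)" and ?J = "tensor_lift (tensor_op \<iota>)"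
  let ?H = "\<lambda>R. tensor_op \<iota> S1 S2 * R * tensor_op \<iota> T1 T2"
  have J: "?J (?G u) = ?H (?J u)" for u
    by (rule clinear_tensor_eqI[OF clinear_comp[OF clinear_lift_tensor_op
            clinear_tmap[OF clinear_sandwich clinear_sandwich]]
          clinear_comp[OF clinear_sandwich clinear_lift_tensor_op]])
      (simp add: tmap_tensor clinear_sandwich lift_tensor_op_tensor tensor_op_mult)
  have "?J ((minus_id ?G ^^ n) (1 \<otimes> 1)) = (minus_id ?H ^^ n) 1"
    by (induction n)
      (simp_all add: lift_tensor_op_tensor tensor_op_one minus_id_def
        clinear_diff[OF clinear_lift_tensor_op] J)
  then show ?thesis
    using lift_tensor_op_eq_0 clinear_0[OF clinear_lift_tensor_op] by (metis beta_eq)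
qed

end

lemma beta_scaleC_right: "beta n S (z *\<^sub>C T) = (minus_id (\<lambda>A. z *\<^sub>C (S * A * T)) ^^ n) 1"
  by (simp add: beta_eq mult_scaleC_right)

lemma one_bop_neq_0:
  assumes "\<exists>x::'x::complex_banach. x \<noteq> 0"
  shows "(1::'x bop) \<noteq> 0"
proof
  assume 1: "(1::'x bop) = 0"
  have "x = 0" for x :: 'x using bop_apply_simps(1,2)[of x] by (simp add: 1)
  with assms show False by blast
qed

theorem theorem1p1:
  fixes S1 T1 :: "'x::complex_banach bop"
    and S2 T2 :: "'y::complex_banach bop"
    and \<alpha> :: "('x, 'y) tensor \<Rightarrow> real"
    and \<iota> :: "('x, 'y) tensor \<Rightarrow> 'z::complex_banach"
    and n :: nat
  assumes "\<exists>x::'x. x \<noteq> 0"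
    and "\<exists>y::'y. y \<noteq> 0"
    and "reasonable_uniform_cross_norm \<alpha>"
    and "is_completion \<alpha> \<iota>"
    and "n \<ge> 1"
  shows "(left_n_inverse n (tensor_op \<iota> S1 S2) (tensor_op \<iota> T1 T2) \<longleftrightarrow>
           (\<exists>(l::nat) (m::nat) (\<mu>::complex). l \<ge> 1 \<and> m \<ge> 1 \<and> l + m = n + 1 \<and> \<mu> \<noteq> 0 \<and>
              left_n_inverse l S1 (\<mu> *\<^sub>C T1) \<and> left_n_inverse m S2 ((1 / \<mu>) *\<^sub>C T2)))
       \<and> (strict_left_n_inverse n (tensor_op \<iota> S1 S2) (tensor_op \<iota> T1 T2) \<longleftrightarrow>
           (\<exists>(l::nat) (m::nat) (\<mu>::complex). l \<ge> 1 \<and> m \<ge> 1 \<and> l + m = n + 1 \<and> \<mu> \<noteq> 0 \<and>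
              strict_left_n_inverse l S1 (\<mu> *\<^sub>C T1) \<and>
              strict_left_n_inverse m S2 ((1 / \<mu>) *\<^sub>C T2)))"
proof -
  have "(1::'x bop) \<noteq> 0" "(1::'y bop) \<noteq> 0" using assms(1,2) by (simp_all add: one_bop_neq_0)
  note main = tensor_annihilated_iff[OF clinear_sandwich clinear_sandwich this assms(5)]
  show ?thesis
    unfolding left_n_inverse_def strict_left_n_inverse_def beta_scaleC_right
      beta_tensor_op_eq_0_iff[OF assms(3,4)]
    by (intro conjI main)
qed

end
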